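(* Let $G(t)$ be a solution of Ricci flow on $\mathcal S^1\times\mathcal S^3$ of the form $$G=(\mathrm ds)^2+f^2\,\omega^1\otimes\omega^1+g^2\,\omega^2\otimes\omega^2+h^2\,\omega^3\otimes\omega^3 .$$ Then any ordering between two of the functions $f,g,h$ (e.g., $f\le g$ or $g\le h$) that holds at the initial time is preserved by Ricci flow, i.e., holds for as long as the solution exists.
   Context: Identify $\mathcal S^3$ with $\mathrm{SU}(2)$, and let $(F_1,F_2,F_3)$ be a fixed left-invariant Milnor frame, $[F_i,F_j]=-2F_k$ for $(i,j,k)$ cyclic, with dual coframe $(\omega^1,\omega^2,\omega^3)$ (so $\sum_i\omega^i\otimes\omega^i$ is the round metric of curvature $1$). Here $\mathrm ds=\rho\,\mathrm d\xi$, and $\rho,f,g,h$ are positive smooth functions of $(\xi,t)$, $\xi\in\mathcal S^1$ (this form of the metric is preserved by Ricci flow $\partial_tG=-2\,\mathrm{Rc}$). *)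

theory Defs
  imports "HOL-Analysis.Analysis"
begin

section \<open>The manifold and its global frame\<close>

definition conj_transpose :: "complex^2^2 \<Rightarrow> complex^2^2" where
  "conj_transpose U = (\<chi> i j. cnj (U $ j $ i))"

definition SU2 :: "(complex^2^2) set" where
  "SU2 = {U. U ** conj_transpose U = mat 1 \<and> det U = 1}"

type_synonym pt = "complex \<times> (complex^2^2)"

abbreviation S1 :: "complex set" where "S1 \<equiv> sphere 0 1"

definition S1xS3 :: "pt set" where
  "S1xS3 = S1 \<times> SU2"

text \<open>
  Frame indices are elements of the four-element type 4, written 0, 1, 2, 3 (and 4 = 0 in this
  type): the index 0 stands for \<open>\<partial>/\<partial>\<xi>\<close>, the indices 1, 2, 3 for the Milnor frame
  \<open>F\<^sub>1, F\<^sub>2, F\<^sub>3\<close>. The latter consists of the left-invariant extensions of \<open>\<i>\<close> times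
  the Pauli matrices. The value at index 0 is irrelevant.
\<close>

definition su2_basis :: "4 \<Rightarrow> complex^2^2" where
  "su2_basis a =
    (if a = 1 then vector [vector [0, \<i>], vector [\<i>, 0]]
     else if a = 2 then vector [vector [0, 1], vector [-1, 0]]
     else if a = 3 then vector [vector [\<i>, 0], vector [0, - \<i>]]
     else 0)"

text \<open>
  The flow of the a-th frame field. A left-invariant field on a matrix group has the flow
  \<open>U \<mapsto> U exp(\<tau> X)\<close>, and \<open>exp(\<tau> X) = cos \<tau> + sin \<tau> X\<close> for each basis element because
  \<open>X\<^sup>2 = -1\<close> (see \<open>su2_basis_square\<close> below).
\<close>

definition frame_flow :: "4 \<Rightarrow> real \<Rightarrow> pt \<Rightarrow> pt" where
  "frame_flow a \<tau> p =
    (if a = 0 then (fst p * cis \<tau>, snd p)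
     else (fst p, snd p ** (cos \<tau> *\<^sub>R mat 1 + sin \<tau> *\<^sub>R su2_basis a)))"

definition frame_deriv :: "4 \<Rightarrow> (pt \<Rightarrow> real) \<Rightarrow> pt \<Rightarrow> real" where
  "frame_deriv a \<phi> p = deriv (\<lambda>\<tau>. \<phi> (frame_flow a \<tau> p)) 0"

text \<open>
  The coefficient of the c-th frame field in the Lie bracket of the a-th and the b-th one:
  \<open>[F\<^sub>i, F\<^sub>j] = -2 F\<^sub>k\<close> for (i, j, k) cyclic, and \<open>\<partial>/\<partial>\<xi>\<close> commutes with everything.
  The bracket of left-invariant fields is the matrix commutator, see
  \<open>su2_basis_commutator\<close> below.
\<close>

definition frame_struct :: "4 \<Rightarrow> 4 \<Rightarrow> 4 \<Rightarrow> real" where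
  "frame_struct a b c =
    (if (a, b, c) \<in> {(1, 2, 3), (2, 3, 1), (3, 1, 2)} then - 2
     else if (b, a, c) \<in> {(1, 2, 3), (2, 3, 1), (3, 1, 2)} then 2
     else 0)"

lemma su2_basis_square:
  assumes "a \<noteq> 0"
  shows "su2_basis a ** su2_basis a = - mat 1"
proof -
  have "(4::4) = 0" by simp
  then have "a = 1 \<or> a = 2 \<or> a = 3" using exhaust_4[of a] assms by auto
  then show ?thesis
    by (elim disjE) (simp_all add: su2_basis_def matrix_matrix_mult_def mat_def vec_eq_iff
      forall_2 sum_2)
qed

lemma su2_basis_commutator:
  assumes "a \<noteq> 0" "b \<noteq> 0"
  shows "su2_basis a ** su2_basis b - su2_basis b ** su2_basis a =
    (\<Sum>c\<in>UNIV. frame_struct a b c *\<^sub>R su2_basis c)"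
proof -
  have "(4::4) = 0" by simp
  then have "a = 1 \<or> a = 2 \<or> a = 3" "b = 1 \<or> b = 2 \<or> b = 3"
    using exhaust_4[of a] exhaust_4[of b] assms by auto
  then show ?thesis
    by (elim disjE) (simp_all add: su2_basis_def frame_struct_def matrix_matrix_mult_def mat_def
      vec_eq_iff forall_2 sum_2 sum_4 scaleR_conv_of_real)
qed

section \<open>Levi-Civita connection and Ricci tensor\<close>

text \<open>
  Vector fields are given by their component functions with respect to the global frame;
  a metric is given pointwise as a bilinear form on frame components.
\<close>

type_synonym vfield = "pt \<Rightarrow> real^4"
type_synonym metric = "pt \<Rightarrow> real^4 \<Rightarrow> real^4 \<Rightarrow> real"

definition const_field :: "real^4 \<Rightarrow> vfield" where
  "const_field v = (\<lambda>p. v)"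

definition frame_field :: "4 \<Rightarrow> vfield" where
  "frame_field a = const_field (axis a 1)"

definition vf_act :: "vfield \<Rightarrow> (pt \<Rightarrow> real) \<Rightarrow> pt \<Rightarrow> real" where
  "vf_act X \<phi> p = (\<Sum>a\<in>UNIV. X p $ a * frame_deriv a \<phi> p)"

definition lie_bracket :: "vfield \<Rightarrow> vfield \<Rightarrow> vfield" where
  "lie_bracket X Y p =
    (\<chi> c. vf_act X (\<lambda>q. Y q $ c) p - vf_act Y (\<lambda>q. X q $ c) p
       + (\<Sum>a\<in>UNIV. \<Sum>b\<in>UNIV. X p $ a * Y p $ b * frame_struct a b c))"

definition koszul :: "metric \<Rightarrow> vfield \<Rightarrow> vfield \<Rightarrow> vfield \<Rightarrow> pt \<Rightarrow> real" where
  "koszul G X Y Z p =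
    vf_act X (\<lambda>q. G q (Y q) (Z q)) p + vf_act Y (\<lambda>q. G q (X q) (Z q)) p
    - vf_act Z (\<lambda>q. G q (X q) (Y q)) p
    + G p (lie_bracket X Y p) (Z p) - G p (lie_bracket X Z p) (Y p)
    - G p (lie_bracket Y Z p) (X p)"

text \<open>The covariant derivative of \<open>Y\<close> along \<open>X\<close>, characterised by the Koszul formula.\<close>

definition levi_civita :: "metric \<Rightarrow> vfield \<Rightarrow> vfield \<Rightarrow> vfield" where
  "levi_civita G X Y p =
    (THE v. \<forall>c. 2 * G p v (axis c 1) = koszul G X Y (frame_field c) p)"

definition riemann :: "metric \<Rightarrow> vfield \<Rightarrow> vfield \<Rightarrow> vfield \<Rightarrow> vfield" where
  "riemann G X Y Z p =
    levi_civita G X (levi_civita G Y Z) p - levi_civita G Y (levi_civita G X Z) p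
    - levi_civita G (lie_bracket X Y) Z p"

text \<open>The trace of \<open>X \<mapsto> R(X, Y) Z\<close>, which is positive on round spheres.\<close>

definition ricci :: "metric \<Rightarrow> vfield \<Rightarrow> vfield \<Rightarrow> pt \<Rightarrow> real" where
  "ricci G Y Z p = (\<Sum>a\<in>UNIV. riemann G (frame_field a) Y Z p $ a)"

definition ricci_flow :: "real set \<Rightarrow> (real \<Rightarrow> metric) \<Rightarrow> bool" where
  "ricci_flow I G \<longleftrightarrow>
    (\<forall>t\<in>I. \<forall>p\<in>S1xS3. \<forall>v w.
      ((\<lambda>s. G s p v w) has_real_derivative
        - 2 * ricci (G t) (const_field v) (const_field w) p) (at t within I))"

section \<open>The metrics under consideration\<close>

text \<open>
  \<open>(ds)\<^sup>2 + f\<^sup>2 \<omega>\<^sup>1\<otimes>\<omega>\<^sup>1 + g\<^sup>2 \<omega>\<^sup>2\<otimes>\<omega>\<^sup>2 + h\<^sup>2 \<omega>\<^sup>3\<otimes>\<omega>\<^sup>3\<close> with \<open>ds = \<rho> d\<xi>\<close>; frame components are the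
  values of the dual coframe \<open>d\<xi>, \<omega>\<^sup>1, \<omega>\<^sup>2, \<omega>\<^sup>3\<close>.
\<close>

definition milnor_metric ::
  "(complex \<Rightarrow> real \<Rightarrow> real) \<Rightarrow> (complex \<Rightarrow> real \<Rightarrow> real) \<Rightarrow> (complex \<Rightarrow> real \<Rightarrow> real) \<Rightarrow>
   (complex \<Rightarrow> real \<Rightarrow> real) \<Rightarrow> real \<Rightarrow> metric" where
  "milnor_metric \<rho> f g h t p v w =
    (\<rho> (fst p) t)\<^sup>2 * (v $ 0 * w $ 0) + (f (fst p) t)\<^sup>2 * (v $ 1 * w $ 1)
    + (g (fst p) t)\<^sup>2 * (v $ 2 * w $ 2) + (h (fst p) t)\<^sup>2 * (v $ 3 * w $ 3)"

text \<open>
  Smoothness on the product of the circle with the time interval \<open>I\<close>, one-sided at end points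
  of \<open>I\<close> that belong to \<open>I\<close>: \<open>D m n\<close> is the m-th \<open>\<xi>\<close>-derivative of the n-th t-derivative.
\<close>

definition smooth_circle_time :: "real set \<Rightarrow> (complex \<Rightarrow> real \<Rightarrow> real) \<Rightarrow> bool" where
  "smooth_circle_time I u \<longleftrightarrow>
    (\<exists>D :: nat \<Rightarrow> nat \<Rightarrow> real \<Rightarrow> real \<Rightarrow> real.
      (\<forall>x. \<forall>t\<in>I. D 0 0 x t = u (cis x) t) \<and>
      (\<forall>m n. continuous_on (UNIV \<times> I) (\<lambda>(x, t). D m n x t)) \<and>
      (\<forall>m n x. \<forall>t\<in>I.
        ((\<lambda>y. D m n y t) has_real_derivative D (Suc m) n x t) (at x) \<and>
        ((\<lambda>s. D m n x s) has_real_derivative D m (Suc n) x t) (at t within I)))"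

end

theory Submission imports Defs begin

text \<open>
  The proof reduces the flow to a system of three scalar equations and applies the maximum principle
  to a difference of two unknowns.

  The functions \<open>\<rho>, f, g, h\<close> depend on the circle coordinate and on time only, and the bracket relations
  of the Milnor frame have constant coefficients. Hence covariant derivatives of frame fields have
  components that are again functions of the circle coordinate, and the Koszul formula gives explicit
  Christoffel symbols (\<open>levi_civita_diag\<close>). Contracting them gives the Ricci curvature in the direction
  of a fibre field (\<open>ricci_diag_spatial\<close>). With \<open>\<partial>\<^sub>s = \<rho>\<^sup>-\<^sup>1 \<partial>\<^sub>\<xi>\<close> the flow becomes
  \<open>f\<^sub>t = f\<^sub>s\<^sub>s + f\<^sub>s (g\<^sub>s/g + h\<^sub>s/h) - 2 (f\<^sup>4 - (g\<^sup>2 - h\<^sup>2)\<^sup>2) / (f g\<^sup>2 h\<^sup>2)\<close>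
  together with its cyclic permutations (\<open>ricci_flow_evolution\<close>).

  These equations are permuted along with \<open>f, g, h\<close>, so the equations of \<open>f\<close> and \<open>g\<close> coincide where the
  two functions and their derivatives do. Hence a difference such as \<open>W = g - f\<close> satisfies an equation
  in which \<open>W\<close> can be factored out of the reaction terms: where \<open>W\<^sub>\<xi> = 0\<close> one has
  \<open>W\<^sub>t = W\<^sub>\<xi>\<^sub>\<xi> / \<rho>\<^sup>2 + c W\<close> with a continuous \<open>c\<close> (\<open>warping_rhs_diff\<close>). On a compact time interval \<open>c\<close> is
  bounded, and the maximum principle on the circle (\<open>circle_maximum_principle\<close>) shows that \<open>W\<close> stays
  nonnegative if it is so initially.
\<close>

section \<open>Sums over the frame indices\<close>

text \<open>
  The numeral 4 denotes the index 0, which is the one that the frame fields are labelled with; the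
  rules for the four-element type that run over 1, 2, 3, 4 are therefore restated.
\<close>

lemma index_cases: "(a :: 4) = 0 \<or> a = 1 \<or> a = 2 \<or> a = 3"
proof -
  have "(4 :: 4) = 0" by simp
  then show ?thesis using exhaust_4[of a] by argo
qed

lemma sum_four: "(\<Sum>a\<in>UNIV. F (a :: 4)) = F 0 + F 1 + F 2 + F 3"
  for F :: "4 \<Rightarrow> 'a :: comm_monoid_add"
proof -
  have UNIV: "(UNIV :: 4 set) = {0, 1, 2, 3}"
    using index_cases by (intro UNIV_eq_I) simp
  show ?thesis unfolding UNIV by (simp add: add.assoc)
qed

section \<open>Derivatives along the circle\<close>

text \<open>
  Differentiation along the rotation flow, as in \<^const>\<open>frame_deriv\<close> with index 0. For a function of
  the circle coordinate the two derivatives are the same term, so that rewriting one into the other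
  leaves no differentiability conditions.
\<close>

definition circle_deriv :: "(complex \<Rightarrow> real) \<Rightarrow> complex \<Rightarrow> real" where
  "circle_deriv \<phi> \<xi> = deriv (\<lambda>\<tau>. \<phi> (\<xi> * cis \<tau>)) 0"

definition circle_differentiable :: "(complex \<Rightarrow> real) \<Rightarrow> bool" where
  "circle_differentiable \<phi> \<longleftrightarrow> (\<forall>\<xi>\<in>S1. (\<lambda>\<tau>. \<phi> (\<xi> * cis \<tau>)) differentiable (at 0))"

lemma circle_deriv_works:
  assumes "circle_differentiable \<phi>" "\<xi> \<in> S1"
  shows "((\<lambda>\<tau>. \<phi> (\<xi> * cis \<tau>)) has_real_derivative circle_deriv \<phi> \<xi>) (at 0)"
  using assms unfolding circle_differentiable_def circle_deriv_def
  by (metis DERIV_imp_deriv real_differentiableE)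

lemma circle_derivI:
  assumes "((\<lambda>\<tau>. \<phi> (\<xi> * cis \<tau>)) has_real_derivative d) (at 0)"
  shows "circle_deriv \<phi> \<xi> = d"
  using assms unfolding circle_deriv_def by (rule DERIV_imp_deriv)

lemma circle_deriv_at_cis:
  assumes "((\<lambda>y. \<phi> (cis y)) has_real_derivative d) (at x)"
  shows "((\<lambda>\<tau>. \<phi> (cis x * cis \<tau>)) has_real_derivative d) (at 0)"
  using assms DERIV_at_within_shift[of "\<lambda>y. \<phi> (cis y)" d x 0 UNIV] by (simp add: cis_mult)

lemma circle_deriv_const [simp]: "circle_deriv (\<lambda>\<xi>. k) \<xi> = 0"
  by (simp add: circle_deriv_def)

lemma circle_differentiable_const: "circle_differentiable (\<lambda>\<xi>. k)"
  by (simp add: circle_differentiable_def)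

text \<open>
  Rotations preserve the circle, so identities that hold only on the circle, such as the one for the
  derivative of a square below, can be differentiated again.
\<close>

lemma circle_deriv_cong:
  assumes "\<And>\<zeta>. \<zeta> \<in> S1 \<Longrightarrow> \<phi> \<zeta> = \<psi> \<zeta>" "\<xi> \<in> S1"
  shows "circle_deriv \<phi> \<xi> = circle_deriv \<psi> \<xi>"
proof -
  have "(\<lambda>\<tau>. \<phi> (\<xi> * cis \<tau>)) = (\<lambda>\<tau>. \<psi> (\<xi> * cis \<tau>))"
    using assms by (simp add: norm_mult)
  then show ?thesis by (simp add: circle_deriv_def)
qed

lemma circle_differentiable_cong:
  assumes "\<And>\<zeta>. \<zeta> \<in> S1 \<Longrightarrow> \<phi> \<zeta> = \<psi> \<zeta>" "circle_differentiable \<psi>"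
  shows "circle_differentiable \<phi>"
proof -
  have "(\<lambda>\<tau>. \<phi> (\<xi> * cis \<tau>)) = (\<lambda>\<tau>. \<psi> (\<xi> * cis \<tau>))" if "\<xi> \<in> S1" for \<xi>
    using assms(1) that by (simp add: norm_mult)
  then show ?thesis using assms(2) by (simp add: circle_differentiable_def)
qed

lemma circle_differentiable_mult:
  "circle_differentiable \<phi> \<Longrightarrow> circle_differentiable \<psi> \<Longrightarrow> circle_differentiable (\<lambda>\<xi>. \<phi> \<xi> * \<psi> \<xi>)"
  by (simp add: circle_differentiable_def)

lemma circle_deriv_mult:
  assumes "circle_differentiable \<phi>" "circle_differentiable \<psi>" "\<xi> \<in> S1"
  shows "circle_deriv (\<lambda>\<xi>. \<phi> \<xi> * \<psi> \<xi>) \<xi> = circle_deriv \<phi> \<xi> * \<psi> \<xi> + \<phi> \<xi> * circle_deriv \<psi> \<xi>"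
  using DERIV_mult[OF circle_deriv_works[OF assms(1,3)] circle_deriv_works[OF assms(2,3)]]
  by (intro circle_derivI) (simp add: mult.commute)

lemma circle_deriv_square:
  assumes u: "circle_differentiable u" and du: "circle_differentiable (circle_deriv u)"
  shows "circle_differentiable (\<lambda>\<xi>. (u \<xi>)\<^sup>2)"
    and "\<xi> \<in> S1 \<Longrightarrow> circle_deriv (\<lambda>\<xi>. (u \<xi>)\<^sup>2) \<xi> = 2 * u \<xi> * circle_deriv u \<xi>"
    and "circle_differentiable (circle_deriv (\<lambda>\<xi>. (u \<xi>)\<^sup>2))"
    and "\<xi> \<in> S1 \<Longrightarrow> circle_deriv (circle_deriv (\<lambda>\<xi>. (u \<xi>)\<^sup>2)) \<xi> =
      2 * ((circle_deriv u \<xi>)\<^sup>2 + u \<xi> * circle_deriv (circle_deriv u) \<xi>)"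
proof -
  show "circle_differentiable (\<lambda>\<xi>. (u \<xi>)\<^sup>2)"
    using circle_differentiable_mult[OF u u] by (simp add: power2_eq_square)
  show d: "circle_deriv (\<lambda>\<xi>. (u \<xi>)\<^sup>2) \<xi> = 2 * u \<xi> * circle_deriv u \<xi>" if "\<xi> \<in> S1" for \<xi>
    using circle_deriv_mult[OF u u that] by (simp add: power2_eq_square)
  have d2: "circle_differentiable (\<lambda>\<xi>. 2 * u \<xi> * circle_deriv u \<xi>)"
    by (intro circle_differentiable_mult circle_differentiable_const u du)
  show "circle_differentiable (circle_deriv (\<lambda>\<xi>. (u \<xi>)\<^sup>2))"
    by (rule circle_differentiable_cong[OF d d2])
  show "circle_deriv (circle_deriv (\<lambda>\<xi>. (u \<xi>)\<^sup>2)) \<xi> =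
      2 * ((circle_deriv u \<xi>)\<^sup>2 + u \<xi> * circle_deriv (circle_deriv u) \<xi>)" if \<xi>: "\<xi> \<in> S1" for \<xi>
  proof -
    have "circle_deriv (circle_deriv (\<lambda>\<xi>. (u \<xi>)\<^sup>2)) \<xi> =
        circle_deriv (\<lambda>\<xi>. 2 * u \<xi> * circle_deriv u \<xi>) \<xi>"
      by (rule circle_deriv_cong[OF _ \<xi>]) (rule d)
    also have "\<dots> = 2 * circle_deriv u \<xi> * circle_deriv u \<xi> + 2 * u \<xi> * circle_deriv (circle_deriv u) \<xi>"
      using circle_deriv_mult[OF circle_differentiable_mult[OF circle_differentiable_const u] du \<xi>, of 2]
        circle_deriv_mult[OF circle_differentiable_const u \<xi>, of 2]
      by simp
    finally show ?thesis by (simp add: power2_eq_square algebra_simps)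
  qed
qed

lemma frame_deriv_circle:
  "frame_deriv a (\<lambda>q. \<phi> (fst q)) p = (if a = 0 then circle_deriv \<phi> (fst p) else 0)"
  by (simp add: frame_deriv_def frame_flow_def circle_deriv_def)

lemma vf_act_circle: "vf_act X (\<lambda>q. \<phi> (fst q)) p = X p $ 0 * circle_deriv \<phi> (fst p)"
  by (simp add: vf_act_def sum_four frame_deriv_circle)

section \<open>The Levi-Civita connection of a diagonal metric\<close>

text \<open>
  The coefficients \<open>E a\<close> are the squares of \<open>\<rho>, f, g, h\<close>. In terms of them the connection is
  rational and the four indices can be treated alike.
\<close>

definition diag_metric :: "(4 \<Rightarrow> complex \<Rightarrow> real) \<Rightarrow> metric" where
  "diag_metric E p v w = (\<Sum>a\<in>UNIV. E a (fst p) * (v $ a * w $ a))"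

lemma diag_metric_axis: "diag_metric E p v (axis c 1) = E c (fst p) * v $ c"
  by (simp add: diag_metric_def axis_def if_distrib if_distribR cong: if_cong)

text \<open>
  Twice the Christoffel symbol with its last index lowered, as the Koszul formula yields it for frame
  fields. The summands with \<^const>\<open>circle_deriv\<close> come from differentiating the metric, which
  depends on the circle coordinate only, and those with \<^const>\<open>frame_struct\<close> from the brackets.
\<close>

definition christoffel_low :: "(4 \<Rightarrow> complex \<Rightarrow> real) \<Rightarrow> 4 \<Rightarrow> 4 \<Rightarrow> 4 \<Rightarrow> complex \<Rightarrow> real" where
  "christoffel_low E a b c \<xi> =
    (of_bool (a = 0 \<and> b = c) + of_bool (b = 0 \<and> a = c)) * circle_deriv (E c) \<xi>
    - of_bool (c = 0 \<and> a = b) * circle_deriv (E a) \<xi>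
    + E c \<xi> * frame_struct a b c - E b \<xi> * frame_struct a c b - E a \<xi> * frame_struct b c a"

definition christoffel :: "(4 \<Rightarrow> complex \<Rightarrow> real) \<Rightarrow> 4 \<Rightarrow> 4 \<Rightarrow> 4 \<Rightarrow> complex \<Rightarrow> real" where
  "christoffel E a b c \<xi> = christoffel_low E a b c \<xi> / (2 * E c \<xi>)"

text \<open>
  The curvature needs iterated covariant derivatives, and a covariant derivative of a frame field has
  components that vary along the circle. So the second argument is a field of this kind. The terms
  with \<open>E a * circle_deriv (y a)\<close> that \<open>F\<^sub>c(G(X, Y))\<close> and \<open>[Y, F\<^sub>c]\<close> produce for \<open>c = 0\<close> cancel.
\<close>

lemma koszul_diag:
  fixes y :: "4 \<Rightarrow> complex \<Rightarrow> real"
  assumes E: "\<And>a. circle_differentiable (E a)"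
    and y: "\<And>a. circle_differentiable (y a)"
    and p: "fst p \<in> S1"
  shows "koszul (diag_metric E) (const_field v) (\<lambda>q. \<chi> c. y c (fst q)) (frame_field c) p =
    2 * E c (fst p) * (v $ 0 * circle_deriv (y c) (fst p))
    + (\<Sum>a\<in>UNIV. \<Sum>b\<in>UNIV. v $ a * y b (fst p) * christoffel_low E a b c (fst p))"
proof -
  have dE: "((\<lambda>\<tau>. E a (fst p * cis \<tau>)) has_real_derivative circle_deriv (E a) (fst p)) (at 0)" for a
    by (rule circle_deriv_works[OF E p])
  have dy: "((\<lambda>\<tau>. y a (fst p * cis \<tau>)) has_real_derivative circle_deriv (y a) (fst p)) (at 0)" for a
    by (rule circle_deriv_works[OF y p])
  let ?dE = "\<lambda>a. circle_deriv (E a) (fst p)" and ?dy = "\<lambda>a. circle_deriv (y a) (fst p)"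
  have d1: "circle_deriv (\<lambda>\<xi>. E c \<xi> * y c \<xi>) (fst p) = ?dE c * y c (fst p) + E c (fst p) * ?dy c"
    by (rule circle_derivI) (auto intro!: derivative_eq_intros dE dy)
  have d2: "circle_deriv (\<lambda>\<xi>. E c \<xi> * v $ c) (fst p) = ?dE c * v $ c"
    by (rule circle_derivI) (auto intro!: derivative_eq_intros dE dy)
  have d3: "circle_deriv (\<lambda>\<xi>. \<Sum>a\<in>UNIV. E a \<xi> * (v $ a * y a \<xi>)) (fst p) =
     (\<Sum>a\<in>UNIV. ?dE a * (v $ a * y a (fst p)) + E a (fst p) * (v $ a * ?dy a))"
    by (rule circle_derivI, rule DERIV_sum)
      (rule derivative_eq_intros dE dy refl | simp add: algebra_simps)+
  let ?X = "const_field v" and ?Y = "\<lambda>q. \<chi> c. y c (fst q)" and ?Z = "frame_field c" and ?G = "diag_metric E"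
  have v1: "vf_act ?X (\<lambda>q. ?G q (?Y q) (?Z q)) p =
      v $ 0 * (?dE c * y c (fst p) + E c (fst p) * ?dy c)"
    using vf_act_circle[of ?X "\<lambda>\<xi>. E c \<xi> * y c \<xi>" p] d1
    by (simp add: const_field_def frame_field_def diag_metric_axis)
  have v2: "vf_act ?Y (\<lambda>q. ?G q (?X q) (?Z q)) p = y 0 (fst p) * (?dE c * v $ c)"
    using vf_act_circle[of ?Y "\<lambda>\<xi>. E c \<xi> * v $ c" p] d2
    by (simp add: const_field_def frame_field_def diag_metric_axis)
  have v3: "vf_act ?Z (\<lambda>q. ?G q (?X q) (?Y q)) p = of_bool (c = 0) *
      (\<Sum>a\<in>UNIV. ?dE a * (v $ a * y a (fst p)) + E a (fst p) * (v $ a * ?dy a))"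
    using vf_act_circle[of ?Z "\<lambda>\<xi>. \<Sum>a\<in>UNIV. E a \<xi> * (v $ a * y a \<xi>)" p] d3
    by (simp add: frame_field_def const_field_def axis_def diag_metric_def)
  have delta: "(\<Sum>a\<in>UNIV. \<Sum>b\<in>UNIV. w a * axis c 1 $ b * s a b) = (\<Sum>a\<in>UNIV. w a * s a c)"
    for w :: "4 \<Rightarrow> real" and s :: "4 \<Rightarrow> 4 \<Rightarrow> real"
    by (simp add: axis_def if_distrib if_distribR cong: if_cong)
  have b1: "?G p (lie_bracket ?X ?Y p) (?Z p) = E c (fst p) *
      (v $ 0 * ?dy c + (\<Sum>a\<in>UNIV. \<Sum>b\<in>UNIV. v $ a * y b (fst p) * frame_struct a b c))"
    using vf_act_circle[of ?X "y c" p] vf_act_circle[of ?Y "\<lambda>\<xi>. v $ c" p]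
    by (simp add: lie_bracket_def const_field_def frame_field_def diag_metric_axis)
  have b2: "?G p (lie_bracket ?X ?Z p) (?Y p) =
      (\<Sum>d\<in>UNIV. E d (fst p) * ((\<Sum>a\<in>UNIV. v $ a * frame_struct a c d) * y d (fst p)))"
    using vf_act_circle[of ?X "\<lambda>\<xi>. axis c 1 $ d" p for d] vf_act_circle[of ?Z "\<lambda>\<xi>. v $ d" p for d]
    by (simp add: lie_bracket_def const_field_def frame_field_def diag_metric_def delta)
  have b3: "?G p (lie_bracket ?Y ?Z p) (?X p) =
      (\<Sum>d\<in>UNIV. E d (fst p) *
        ((- (of_bool (c = 0) * ?dy d) + (\<Sum>b\<in>UNIV. y b (fst p) * frame_struct b c d)) * v $ d))"
    using vf_act_circle[of ?Z "y d" p for d] vf_act_circle[of ?Y "\<lambda>\<xi>. axis c 1 $ d" p for d]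
    by (simp add: lie_bracket_def const_field_def frame_field_def diag_metric_def delta)
      (simp add: axis_def)
  have "koszul ?G ?X ?Y ?Z p = 2 * E c (fst p) * (v $ 0 * ?dy c)
    + (\<Sum>a\<in>UNIV. \<Sum>b\<in>UNIV. v $ a * y b (fst p) * christoffel_low E a b c (fst p))"
  proof -
    consider "c = 0" | "c = 1" | "c = 2" | "c = 3" using index_cases[of c] by blast
    then show ?thesis
      unfolding koszul_def v1 v2 v3 b1 b2 b3
      by cases (simp_all add: sum_four christoffel_low_def frame_struct_def algebra_simps)
  qed
  then show ?thesis .
qed

text \<open>
  The metric is known to be nondegenerate only over the circle, and there the connection has an
  explicit formula. Inserting it into a second covariant derivative is legitimate because the frame flows do not leave this set.
\<close>

definition agree_over_circle :: "(pt \<Rightarrow> 'a) \<Rightarrow> (pt \<Rightarrow> 'a) \<Rightarrow> bool" where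
  "agree_over_circle X Y \<longleftrightarrow> (\<forall>q. fst q \<in> S1 \<longrightarrow> X q = Y q)"

lemma frame_flow_circle: "fst p \<in> S1 \<Longrightarrow> fst (frame_flow a \<tau> p) \<in> S1"
  by (simp add: frame_flow_def norm_mult)

lemma frame_deriv_cong:
  assumes "agree_over_circle \<phi> \<psi>" "fst p \<in> S1"
  shows "frame_deriv a \<phi> p = frame_deriv a \<psi> p"
proof -
  have "(\<lambda>\<tau>. \<phi> (frame_flow a \<tau> p)) = (\<lambda>\<tau>. \<psi> (frame_flow a \<tau> p))"
    using assms(1) frame_flow_circle[OF assms(2)] unfolding agree_over_circle_def by blast
  then show ?thesis by (simp add: frame_deriv_def)
qed

lemma levi_civita_cong:
  assumes Y: "agree_over_circle Y Y'" and p: "fst p \<in> S1"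
  shows "levi_civita G X Y p = levi_civita G X Y' p"
proof -
  have [simp]: "Y p = Y' p" using Y p unfolding agree_over_circle_def by blast
  \<comment> \<open>\<open>F\<close> will be a component map for the Lie brackets and a metric pairing for the derivative
    terms of the Koszul formula.\<close>
  have act_applied: "vf_act Z (\<lambda>q. F q (Y q)) p = vf_act Z (\<lambda>q. F q (Y' q)) p" for Z F
    unfolding vf_act_def using Y p
    by (intro sum.cong refl arg_cong2[where f = "(*)"] frame_deriv_cong)
      (auto simp: agree_over_circle_def)
  have act_along: "vf_act Y \<phi> p = vf_act Y' \<phi> p" for \<phi>
    by (simp add: vf_act_def)
  have br1: "lie_bracket X Y p = lie_bracket X Y' p" for X
    using act_applied[of X "\<lambda>q y. y $ c" for c] act_along by (simp add: lie_bracket_def)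
  have br2: "lie_bracket Y Z p = lie_bracket Y' Z p" for Z
    using act_applied[of Z "\<lambda>q y. y $ c" for c] act_along by (simp add: lie_bracket_def)
  have "koszul G X Y Z p = koszul G X Y' Z p" for Z
    using act_applied[of X "\<lambda>q y. G q y (Z q)"] act_applied[of Z "\<lambda>q y. G q (X q) y"]
    by (simp add: koszul_def act_along br1 br2)
  then show ?thesis by (simp add: levi_civita_def)
qed

text \<open>
  A diagonal metric with nonzero coefficients determines a vector by its pairings with the frame, so
  the definite description in \<^const>\<open>levi_civita\<close> has exactly one solution.
\<close>

lemma levi_civita_diag:
  fixes y :: "4 \<Rightarrow> complex \<Rightarrow> real"
  assumes E: "\<And>a. circle_differentiable (E a)"
    and E_nonzero: "\<forall>a. \<forall>\<xi>\<in>S1. E a \<xi> \<noteq> 0"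
    and y: "\<And>a. circle_differentiable (y a)"
    and p: "fst p \<in> S1"
  shows "levi_civita (diag_metric E) (const_field v) (\<lambda>q. \<chi> c. y c (fst q)) p =
    (\<chi> c. v $ 0 * circle_deriv (y c) (fst p)
      + (\<Sum>a\<in>UNIV. \<Sum>b\<in>UNIV. v $ a * y b (fst p) * christoffel E a b c (fst p)))"
    (is "_ = ?V")
  unfolding levi_civita_def
proof (rule the_equality)
  have nz: "E c (fst p) \<noteq> 0" for c using E_nonzero p by blast
  have V: "2 * diag_metric E p ?V (axis c 1) =
    koszul (diag_metric E) (const_field v) (\<lambda>q. \<chi> c. y c (fst q)) (frame_field c) p" for c
    using nz[of c]
    by (simp add: koszul_diag[OF E y p] diag_metric_axis distrib_left sum_distrib_left christoffel_def)
  then show "\<forall>c. 2 * diag_metric E p ?V (axis c 1) =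
    koszul (diag_metric E) (const_field v) (\<lambda>q. \<chi> c. y c (fst q)) (frame_field c) p" by blast
  fix w
  assume w: "\<forall>c. 2 * diag_metric E p w (axis c 1) =
    koszul (diag_metric E) (const_field v) (\<lambda>q. \<chi> c. y c (fst q)) (frame_field c) p"
  have "diag_metric E p w (axis c 1) = diag_metric E p ?V (axis c 1)" for c
    using V[of c] spec[OF w, of c] by linarith
  then show "w = ?V"
    unfolding diag_metric_axis using nz by (simp add: vec_eq_iff del: vec_lambda_beta)
qed

lemma circle_differentiable_christoffel:
  assumes E: "\<And>a. circle_differentiable (E a)"
    and dE: "\<And>a. circle_differentiable (circle_deriv (E a))"
    and E_nonzero: "\<forall>a. \<forall>\<xi>\<in>S1. E a \<xi> \<noteq> 0"
  shows "circle_differentiable (christoffel E a b c)"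
  unfolding circle_differentiable_def christoffel_def christoffel_low_def
proof
  fix \<xi> :: complex
  assume \<xi>: "\<xi> \<in> S1"
  have diff: "(\<lambda>\<tau>. E a (\<xi> * cis \<tau>)) differentiable (at 0)"
    "(\<lambda>\<tau>. circle_deriv (E a) (\<xi> * cis \<tau>)) differentiable (at 0)" for a
    using E[of a] dE[of a] \<xi> unfolding circle_differentiable_def by blast+
  show "(\<lambda>\<tau>. ((of_bool (a = 0 \<and> b = c) + of_bool (b = 0 \<and> a = c)) *
      circle_deriv (E c) (\<xi> * cis \<tau>)
      - of_bool (c = 0 \<and> a = b) * circle_deriv (E a) (\<xi> * cis \<tau>)
      + E c (\<xi> * cis \<tau>) * frame_struct a b c - E b (\<xi> * cis \<tau>) * frame_struct a c b
      - E a (\<xi> * cis \<tau>) * frame_struct b c a) / (2 * E c (\<xi> * cis \<tau>))) differentiable (at 0)"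
    using E_nonzero \<xi>
    by (intro differentiable_divide differentiable_diff differentiable_add differentiable_mult
        differentiable_const diff) simp
qed

lemma sum_axis_mult: "(\<Sum>a\<in>UNIV. axis i 1 $ a * w a) = (w i :: real)"
  by (simp add: axis_def if_distrib[of "\<lambda>z. z * _"] cong: if_cong)

lemma double_sum_axis_mult:
  fixes y :: "4 \<Rightarrow> real"
  shows "(\<Sum>a\<in>UNIV. \<Sum>b\<in>UNIV. axis i 1 $ a * y b * s a b) = (\<Sum>b\<in>UNIV. y b * s i b)"
  by (simp add: mult.assoc sum_distrib_left[symmetric] sum_axis_mult)

lemma lie_bracket_frame:
  "lie_bracket (frame_field a) (frame_field b) = const_field (\<chi> c. frame_struct a b c)"
proof
  fix p
  have "vf_act X (\<lambda>q. k) p = 0" for X k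
    using vf_act_circle[of X "\<lambda>\<xi>. k" p] by simp
  then show "lie_bracket (frame_field a) (frame_field b) p = const_field (\<chi> c. frame_struct a b c) p"
    by (simp add: lie_bracket_def const_field_def frame_field_def double_sum_axis_mult sum_axis_mult)
qed

section \<open>The Ricci tensor of a diagonal metric\<close>

context
  fixes E :: "4 \<Rightarrow> complex \<Rightarrow> real"
  assumes E: "\<And>a. circle_differentiable (E a)"
    and dE: "\<And>a. circle_differentiable (circle_deriv (E a))"
    and E_nonzero: "\<forall>a. \<forall>\<xi>\<in>S1. E a \<xi> \<noteq> 0"
begin

lemma levi_civita_const:
  assumes p: "fst p \<in> S1"
  shows "levi_civita (diag_metric E) (const_field v) (frame_field b) p =
    (\<chi> c. \<Sum>a\<in>UNIV. v $ a * christoffel E a b c (fst p))"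
proof -
  have eq: "frame_field b = (\<lambda>q. \<chi> c. of_bool (c = b))"
    by (simp add: frame_field_def const_field_def axis_def fun_eq_iff vec_eq_iff)
  show ?thesis
    unfolding eq
      levi_civita_diag[where y = "\<lambda>c \<xi>. of_bool (c = b)", OF E E_nonzero circle_differentiable_const p]
    by (simp add: of_bool_def if_distrib if_distribR cong: if_cong)
qed

lemma levi_civita_frame:
  assumes p: "fst p \<in> S1"
  shows "levi_civita (diag_metric E) (frame_field a) (frame_field b) p =
    (\<chi> c. christoffel E a b c (fst p))"
  using levi_civita_const[OF p, of "axis a 1" b]
  by (simp add: frame_field_def axis_def if_distrib if_distribR cong: if_cong)

lemma levi_civita_frame_frame:
  assumes p: "fst p \<in> S1"
  shows "levi_civita (diag_metric E) (frame_field d)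
      (levi_civita (diag_metric E) (frame_field a) (frame_field b)) p $ c =
    of_bool (d = 0) * circle_deriv (christoffel E a b c) (fst p)
    + (\<Sum>e\<in>UNIV. christoffel E a b e (fst p) * christoffel E d e c (fst p))"
proof -
  have agree: "agree_over_circle (levi_civita (diag_metric E) (frame_field a) (frame_field b))
      (\<lambda>q. \<chi> c. christoffel E a b c (fst q))"
    by (simp add: agree_over_circle_def levi_civita_frame)
  show ?thesis
    unfolding levi_civita_cong[OF agree p] frame_field_def[of d]
      levi_civita_diag[where y = "christoffel E a b",
        OF E E_nonzero circle_differentiable_christoffel[OF E dE E_nonzero] p]
    by (simp add: double_sum_axis_mult) (simp add: axis_def)
qed

text \<open>
  The trace of \<open>\<nabla>\<^sub>a\<nabla>\<^sub>iF\<^sub>i - \<nabla>\<^sub>i\<nabla>\<^sub>aF\<^sub>i - \<nabla>\<^bsub>[F\<^sub>a,F\<^sub>i]\<^esub>F\<^sub>i\<close> over \<open>a\<close>, expressed by Christoffel symbols.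
\<close>

lemma ricci_diag:
  assumes p: "fst p \<in> S1"
  shows "ricci (diag_metric E) (frame_field i) (frame_field i) p =
    (\<Sum>a\<in>UNIV. of_bool (a = 0) * circle_deriv (christoffel E i i a) (fst p)
      + (\<Sum>e\<in>UNIV. christoffel E i i e (fst p) * christoffel E a e a (fst p))
      - (of_bool (i = 0) * circle_deriv (christoffel E a i a) (fst p)
        + (\<Sum>e\<in>UNIV. christoffel E a i e (fst p) * christoffel E i e a (fst p)))
      - (\<Sum>d\<in>UNIV. frame_struct a i d * christoffel E d i a (fst p)))"
  unfolding ricci_def riemann_def lie_bracket_frame
  by (simp add: levi_civita_frame_frame[OF p] levi_civita_const[OF p])

lemma frame_struct_values:
  "frame_struct 1 2 3 = - 2" "frame_struct 2 3 1 = - 2" "frame_struct 3 1 2 = - 2"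
  "frame_struct 2 1 3 = 2" "frame_struct 3 2 1 = 2" "frame_struct 1 3 2 = 2"
  "frame_struct 0 b c = 0" "frame_struct a 0 c = 0" "frame_struct a b 0 = 0"
  "frame_struct a a c = 0" "frame_struct a b a = 0" "frame_struct a b b = 0"
  by (auto simp: frame_struct_def)

text \<open>
  At most sixteen of the sixty-four Christoffel symbols do not vanish: those that record how the
  lengths of the frame fields vary along the circle, and those with three distinct indices from
  1, 2, 3, which are the ones of the left-invariant metric on the fibre. Rewriting with this table
  keeps the contraction in the Ricci tensor small.
\<close>

lemma christoffel_zero:
  "c \<noteq> 0 \<Longrightarrow> christoffel E a a c \<xi> = 0" "b \<noteq> 0 \<Longrightarrow> christoffel E a b a \<xi> = 0"
  "a \<noteq> 0 \<Longrightarrow> christoffel E a b b \<xi> = 0" "b \<noteq> c \<Longrightarrow> christoffel E 0 b c \<xi> = 0"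
  "a \<noteq> c \<Longrightarrow> christoffel E a 0 c \<xi> = 0" "a \<noteq> b \<Longrightarrow> christoffel E a b 0 \<xi> = 0"
  by (auto simp: christoffel_def christoffel_low_def frame_struct_values)

lemma christoffel_warping:
  "christoffel E 0 a a \<xi> = circle_deriv (E a) \<xi> / (2 * E a \<xi>)"
  "christoffel E a 0 a \<xi> = circle_deriv (E a) \<xi> / (2 * E a \<xi>)"
  "a \<noteq> 0 \<Longrightarrow> christoffel E a a 0 \<xi> = - circle_deriv (E a) \<xi> / (2 * E 0 \<xi>)"
  by (auto simp: christoffel_def christoffel_low_def frame_struct_values)

lemma christoffel_fibre:
  "christoffel E 1 2 3 \<xi> = (E 1 \<xi> - E 2 \<xi> - E 3 \<xi>) / E 3 \<xi>"
  "christoffel E 2 3 1 \<xi> = (E 2 \<xi> - E 3 \<xi> - E 1 \<xi>) / E 1 \<xi>"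
  "christoffel E 3 1 2 \<xi> = (E 3 \<xi> - E 1 \<xi> - E 2 \<xi>) / E 2 \<xi>"
  "christoffel E 2 1 3 \<xi> = - (E 2 \<xi> - E 1 \<xi> - E 3 \<xi>) / E 3 \<xi>"
  "christoffel E 3 2 1 \<xi> = - (E 3 \<xi> - E 2 \<xi> - E 1 \<xi>) / E 1 \<xi>"
  "christoffel E 1 3 2 \<xi> = - (E 1 \<xi> - E 3 \<xi> - E 2 \<xi>) / E 2 \<xi>"
  by (simp_all add: christoffel_def christoffel_low_def frame_struct_values add_divide_distrib
      diff_divide_distrib)

text \<open>
  The contraction splits into a warping part and a part in which all three fibre indices occur. The
  latter is the Ricci curvature of the left-invariant metric \<open>diag(E\<^sub>1, E\<^sub>2, E\<^sub>3)\<close> on the three-sphere;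
  for \<open>E\<^sub>1 = E\<^sub>2 = E\<^sub>3 = 1\<close> it has the value 2 of the unit sphere.
\<close>

lemma ricci_diag_spatial:
  assumes p: "fst p \<in> S1" and ijk: "(i, j, k) \<in> {(1, 2, 3), (2, 3, 1), (3, 1, 2)}"
    and \<xi>: "\<xi> = fst p"
  shows "ricci (diag_metric E) (frame_field i) (frame_field i) p =
    - circle_deriv (circle_deriv (E i)) \<xi> / (2 * E 0 \<xi>)
    + circle_deriv (E i) \<xi> * circle_deriv (E 0) \<xi> / (4 * (E 0 \<xi>)\<^sup>2)
    + (circle_deriv (E i) \<xi>)\<^sup>2 / (4 * E i \<xi> * E 0 \<xi>)
    - circle_deriv (E i) \<xi> / (4 * E 0 \<xi>) *
      (circle_deriv (E j) \<xi> / E j \<xi> + circle_deriv (E k) \<xi> / E k \<xi>)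
    + 2 * ((E i \<xi>)\<^sup>2 - (E j \<xi> - E k \<xi>)\<^sup>2) / (E j \<xi> * E k \<xi>)"
proof -
  have \<xi>': "\<xi> \<in> S1" using p \<xi> by simp
  have nz: "E c \<xi> \<noteq> 0" for c using E_nonzero \<xi>' by blast
  have DE: "((\<lambda>\<tau>. E a (\<xi> * cis \<tau>)) has_real_derivative circle_deriv (E a) \<xi>) (at 0)" for a
    by (rule circle_deriv_works[OF E \<xi>'])
  have DDE: "((\<lambda>\<tau>. circle_deriv (E a) (\<xi> * cis \<tau>)) has_real_derivative
      circle_deriv (circle_deriv (E a)) \<xi>) (at 0)" for a
    by (rule circle_deriv_works[OF dE \<xi>'])
  have i: "i \<noteq> 0" using ijk by auto
  have \<Gamma>: "christoffel E i i 0 = (\<lambda>\<xi>. - circle_deriv (E i) \<xi> / (2 * E 0 \<xi>))"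
    using christoffel_warping(3)[OF i] by blast
  have d\<Gamma>: "circle_deriv (christoffel E i i 0) \<xi> =
      - (circle_deriv (circle_deriv (E i)) \<xi> / (2 * E 0 \<xi>))
      + circle_deriv (E i) \<xi> * circle_deriv (E 0) \<xi> / (2 * (E 0 \<xi>)\<^sup>2)"
    unfolding \<Gamma>
    by (rule circle_derivI)
      (rule derivative_eq_intros DE DDE refl | simp add: nz field_simps power2_eq_square)+
  define w where "w a = circle_deriv (E a) \<xi> / (2 * E a \<xi>)" for a
  have w: "christoffel E 0 a a \<xi> = w a" "christoffel E a 0 a \<xi> = w a" for a
    by (simp_all add: christoffel_warping(1,2) w_def)
  have contracted: "ricci (diag_metric E) (frame_field i) (frame_field i) p =
    circle_deriv (christoffel E i i 0) \<xi>
    + christoffel E i i 0 \<xi> * (w 0 + w i + w j + w k)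
    - 2 * w i * christoffel E i i 0 \<xi>
    - christoffel E j i k \<xi> * christoffel E i k j \<xi>
    - christoffel E k i j \<xi> * christoffel E i j k \<xi>
    + 2 * christoffel E j i k \<xi> - 2 * christoffel E k i j \<xi>"
    using ijk unfolding ricci_diag[OF p] \<xi>[symmetric]
    by (elim insertE emptyE)
      (simp_all add: sum_four christoffel_zero frame_struct_values w algebra_simps)
  have fibre: "- christoffel E j i k \<xi> * christoffel E i k j \<xi>
    - christoffel E k i j \<xi> * christoffel E i j k \<xi>
    + 2 * christoffel E j i k \<xi> - 2 * christoffel E k i j \<xi> =
    2 * ((E i \<xi>)\<^sup>2 - (E j \<xi> - E k \<xi>)\<^sup>2) / (E j \<xi> * E k \<xi>)"
    using ijk nz[of 1] nz[of 2] nz[of 3]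
    by (elim insertE emptyE)
      (simp_all add: christoffel_fibre field_simps power2_eq_square)
  have warping: "christoffel E i i 0 \<xi> * (w 0 + w i + w j + w k) - 2 * w i * christoffel E i i 0 \<xi> =
    - circle_deriv (E i) \<xi> * circle_deriv (E 0) \<xi> / (4 * (E 0 \<xi>)\<^sup>2)
    + (circle_deriv (E i) \<xi>)\<^sup>2 / (4 * E i \<xi> * E 0 \<xi>)
    - circle_deriv (E i) \<xi> / (4 * E 0 \<xi>) *
      (circle_deriv (E j) \<xi> / E j \<xi> + circle_deriv (E k) \<xi> / E k \<xi>)"
    using nz[of 0] nz[of i] nz[of j] nz[of k]
    by (simp add: w_def \<Gamma> field_simps power2_eq_square)
  show ?thesis
    using contracted fibre warping d\<Gamma> by (simp add: field_simps)
qed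

end

section \<open>A maximum principle on the circle\<close>

lemma local_min_second_deriv_nonneg:
  fixes \<phi> :: "real \<Rightarrow> real"
  assumes d1: "\<And>y. (\<phi> has_real_derivative \<phi>' y) (at y)"
    and d2: "(\<phi>' has_real_derivative d) (at x)"
    and min: "\<And>y. \<phi> x \<le> \<phi> y"
  shows "\<phi>' x = 0" "0 \<le> d"
proof -
  show zero: "\<phi>' x = 0"
    using DERIV_local_min[OF d1[of x], of 1] min by simp
  show "0 \<le> d"
  proof (rule ccontr)
    assume "\<not> 0 \<le> d"
    then obtain e where e: "e > 0" "\<And>h. h > 0 \<Longrightarrow> h < e \<Longrightarrow> \<phi>' (x + h) < 0"
      using DERIV_neg_dec_right[OF d2] zero by auto
    obtain z where z: "z > x" "z < x + e / 2" "\<phi> (x + e / 2) - \<phi> x = (x + e / 2 - x) * \<phi>' z"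
      using MVT2[of x "x + e / 2" \<phi> \<phi>'] d1 e(1) by auto
    have "\<phi>' z < 0" using e(2)[of "z - x"] z e(1) by simp
    then have "\<phi> (x + e / 2) < \<phi> x"
      using z(3) e(1) mult_pos_neg[of "e / 2" "\<phi>' z"] by simp
    with min[of "x + e / 2"] show False by simp
  qed
qed

lemma circle_point_param:
  assumes "\<xi> \<in> S1"
  obtains x where "x \<in> {0..2 * pi}" "\<xi> = cis x"
proof
  show "Arg2pi \<xi> \<in> {0..2 * pi}" using Arg2pi[of \<xi>] by simp
  show "\<xi> = cis (Arg2pi \<xi>)"
    using assms complex_norm_eq_1_exp[of \<xi>] by (simp add: cis_conv_exp)
qed

text \<open>
  The differential inequality \<open>K * W \<le> W\<^sub>t\<close> is asked for only where it is needed: at a point where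
  \<open>W\<close> is negative and the first and second derivatives have the values that they have at a spatial
  minimum. In the proof \<open>W\<close> is multiplied by \<open>exp (- (K + 1) * t)\<close>. If the product had a negative
  minimum over space and time, its time derivative there would be at least
  \<open>- exp (- (K + 1) * t) * W > 0\<close>, so slightly earlier values would be smaller still. The 1 in \<open>K + 1\<close>
  provides the strict inequality.
\<close>

lemma circle_maximum_principle:
  fixes W :: "complex \<Rightarrow> real \<Rightarrow> real"
  assumes cont: "continuous_on ({0..2 * pi} \<times> {t0..T}) (\<lambda>(x, t). W (cis x) t)"
    and dx: "\<And>x t. t \<in> {t0..T} \<Longrightarrow> ((\<lambda>y. W (cis y) t) has_real_derivative W1 x t) (at x)"
    and dxx: "\<And>x t. t \<in> {t0..T} \<Longrightarrow> ((\<lambda>y. W1 y t) has_real_derivative W2 x t) (at x)"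
    and dt: "\<And>x t. t \<in> {t0..T} \<Longrightarrow>
      ((\<lambda>s. W (cis x) s) has_real_derivative Wt x t) (at t within {t0..T})"
    and supersol: "\<And>x t. \<lbrakk>x \<in> {0..2 * pi}; t \<in> {t0..T}; W (cis x) t < 0; W1 x t = 0; W2 x t \<ge> 0\<rbrakk>
      \<Longrightarrow> K * W (cis x) t \<le> Wt x t"
    and init: "\<And>\<xi>. \<xi> \<in> S1 \<Longrightarrow> 0 \<le> W \<xi> t0"
    and t: "t \<in> {t0..T}" and \<xi>: "\<xi> \<in> S1"
  shows "0 \<le> W \<xi> t"
proof -
  define Z where "Z = (\<lambda>(x, s). exp (- (K + 1) * s) * W (cis x) s)"
  have "continuous_on ({0..2 * pi} \<times> {t0..T}) Z"
    using cont unfolding Z_def case_prod_unfold by (intro continuous_intros)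
  moreover have "compact ({0..2 * pi} \<times> {t0..T})"
    by (intro compact_Times compact_Icc)
  moreover have "{0..2 * pi} \<times> {t0..T} \<noteq> {}" using t by auto
  ultimately obtain m where m: "m \<in> {0..2 * pi} \<times> {t0..T}"
      "\<And>q. q \<in> {0..2 * pi} \<times> {t0..T} \<Longrightarrow> Z m \<le> Z q"
    using continuous_attains_inf by metis
  obtain x s where xs: "m = (x, s)" "x \<in> {0..2 * pi}" "s \<in> {t0..T}" using m(1) by auto
  \<comment> \<open>By periodicity the minimum over one period is one over the whole line, so \<open>x\<close> is an interior
    minimum even if it is an end point of the period.\<close>
  have min: "Z (x, s) \<le> Z (y, r)" if r: "r \<in> {t0..T}" for y r
  proof -
    obtain y' where "y' \<in> {0..2 * pi}" "cis y = cis y'"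
      using circle_point_param[of "cis y"] by auto
    then show ?thesis using m(2)[of "(y', r)"] r xs(1) by (simp add: Z_def)
  qed
  have nonneg: "0 \<le> W (cis x) s"
  proof (rule ccontr)
    assume neg: "\<not> 0 \<le> W (cis x) s"
    have "s \<noteq> t0" using neg init[of "cis x"] by auto
    then have s: "t0 < s" using xs(3) by simp
    have "W (cis x) s \<le> W (cis y) s" for y
      using min[OF xs(3), of y] by (simp add: Z_def)
    from local_min_second_deriv_nonneg[OF dx[OF xs(3)] dxx[OF xs(3)] this]
    have "W1 x s = 0" "0 \<le> W2 x s" by auto
    then have "K * W (cis x) s \<le> Wt x s" using supersol xs neg by simp
    then have "0 < Wt x s - (K + 1) * W (cis x) s" using neg by (simp add: algebra_simps)
    then have pos: "0 < exp (- (K + 1) * s) * (Wt x s - (K + 1) * W (cis x) s)" by simp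
    have "((\<lambda>r. Z (x, r)) has_real_derivative
        exp (- (K + 1) * s) * (Wt x s - (K + 1) * W (cis x) s)) (at s within {t0..T})"
      unfolding Z_def case_prod_conv
      by (rule derivative_eq_intros dt[OF xs(3)] refl)+ (simp add: algebra_simps)
    from has_real_derivative_pos_inc_left[OF this pos] obtain e
      where e: "e > 0" "\<And>h. h > 0 \<Longrightarrow> s - h \<in> {t0..T} \<Longrightarrow> h < e \<Longrightarrow> Z (x, s - h) < Z (x, s)"
      by blast
    define h where "h = min (e / 2) (s - t0)"
    have "h > 0" "h < e" "s - h \<in> {t0..T}" using s e(1) xs(3) by (auto simp: h_def)
    with e(2) min[of "s - h" x] show False by fastforce
  qed
  obtain y where y: "\<xi> = cis y" using circle_point_param[OF \<xi>] by metis
  have "0 \<le> Z (x, s)" using nonneg by (simp add: Z_def)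
  also have "\<dots> \<le> Z (y, t)" by (rule min[OF t])
  finally show ?thesis by (simp add: Z_def y zero_le_mult_iff)
qed

section \<open>The evolution of the warping functions\<close>

lemma smooth_circle_time_deriv:
  assumes "smooth_circle_time I u"
  shows "continuous_on (UNIV \<times> I) (\<lambda>(x, t). u (cis x) t)"
    and "continuous_on (UNIV \<times> I) (\<lambda>(x, t). circle_deriv (\<lambda>\<xi>. u \<xi> t) (cis x))"
    and "t \<in> I \<Longrightarrow> ((\<lambda>y. u (cis y) t) has_real_derivative circle_deriv (\<lambda>\<xi>. u \<xi> t) (cis x)) (at x)"
    and "t \<in> I \<Longrightarrow> ((\<lambda>y. circle_deriv (\<lambda>\<xi>. u \<xi> t) (cis y)) has_real_derivative
      circle_deriv (circle_deriv (\<lambda>\<xi>. u \<xi> t)) (cis x)) (at x)"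
proof -
  obtain D :: "nat \<Rightarrow> nat \<Rightarrow> real \<Rightarrow> real \<Rightarrow> real"
    where D0: "\<And>x t. t \<in> I \<Longrightarrow> D 0 0 x t = u (cis x) t"
      and cont: "\<And>m n. continuous_on (UNIV \<times> I) (\<lambda>(x, t). D m n x t)"
      and Dx: "\<And>m n x t. t \<in> I \<Longrightarrow> ((\<lambda>y. D m n y t) has_real_derivative D (Suc m) n x t) (at x)"
    using assms unfolding smooth_circle_time_def by metis
  have d1: "((\<lambda>y. u (cis y) t) has_real_derivative D 1 0 x t) (at x)" if "t \<in> I" for x t
    using Dx[OF that, of 0 0 x] D0[OF that] by simp
  have D1: "circle_deriv (\<lambda>\<xi>. u \<xi> t) (cis x) = D 1 0 x t" if "t \<in> I" for x t
    by (rule circle_derivI[OF circle_deriv_at_cis[OF d1[OF that]]])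
  have d2: "((\<lambda>y. circle_deriv (\<lambda>\<xi>. u \<xi> t) (cis y)) has_real_derivative D 2 0 x t) (at x)"
    if "t \<in> I" for x t
    using Dx[OF that, of 1 0 x] D1[OF that] by (simp add: numeral_2_eq_2)
  have D2: "circle_deriv (circle_deriv (\<lambda>\<xi>. u \<xi> t)) (cis x) = D 2 0 x t" if "t \<in> I" for x t
    by (rule circle_derivI[OF circle_deriv_at_cis[OF d2[OF that]]])
  show "continuous_on (UNIV \<times> I) (\<lambda>(x, t). u (cis x) t)"
    by (rule continuous_on_eq[OF cont[of 0 0]]) (auto simp: D0)
  show "continuous_on (UNIV \<times> I) (\<lambda>(x, t). circle_deriv (\<lambda>\<xi>. u \<xi> t) (cis x))"
    by (rule continuous_on_eq[OF cont[of 1 0]]) (auto simp: D1)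
  show "t \<in> I \<Longrightarrow> ((\<lambda>y. u (cis y) t) has_real_derivative circle_deriv (\<lambda>\<xi>. u \<xi> t) (cis x)) (at x)"
    using d1 D1 by simp
  show "t \<in> I \<Longrightarrow> ((\<lambda>y. circle_deriv (\<lambda>\<xi>. u \<xi> t) (cis y)) has_real_derivative
      circle_deriv (circle_deriv (\<lambda>\<xi>. u \<xi> t)) (cis x)) (at x)"
    using d2 D2 by simp
qed

lemma smooth_circle_time_differentiable:
  assumes u: "smooth_circle_time I u" and t: "t \<in> I"
  shows "circle_differentiable (\<lambda>\<xi>. u \<xi> t)" "circle_differentiable (circle_deriv (\<lambda>\<xi>. u \<xi> t))"
proof -
  have *: "circle_differentiable \<phi>"
    if "\<And>x. ((\<lambda>y. \<phi> (cis y)) has_real_derivative d x) (at x)" for \<phi> d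
    unfolding circle_differentiable_def
  proof
    fix \<xi> :: complex
    assume "\<xi> \<in> S1"
    then obtain x where "\<xi> = cis x" by (rule circle_point_param)
    then show "(\<lambda>\<tau>. \<phi> (\<xi> * cis \<tau>)) differentiable (at 0)"
      using circle_deriv_at_cis[OF that, of x] real_differentiable_def by blast
  qed
  show "circle_differentiable (\<lambda>\<xi>. u \<xi> t)" "circle_differentiable (circle_deriv (\<lambda>\<xi>. u \<xi> t))"
    by (rule *, rule smooth_circle_time_deriv(3,4)[OF u t])+
qed

text \<open>
  In terms of arclength, where \<open>\<partial>\<^sub>s = \<rho>\<^sup>-\<^sup>1 \<partial>\<^sub>\<xi>\<close>, this is
  \<open>u\<^sub>s\<^sub>s + u\<^sub>s (v\<^sub>s/v + w\<^sub>s/w) - 2 (u\<^sup>4 - (v\<^sup>2 - w\<^sup>2)\<^sup>2) / (u v\<^sup>2 w\<^sup>2)\<close>: the right-hand side of the evolution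
  equation that the Ricci flow imposes on the warping function \<open>u\<close>.
\<close>

definition warping_rhs ::
  "(complex \<Rightarrow> real) \<Rightarrow> (complex \<Rightarrow> real) \<Rightarrow> (complex \<Rightarrow> real) \<Rightarrow> (complex \<Rightarrow> real) \<Rightarrow> complex \<Rightarrow> real" where
  "warping_rhs \<rho> u v w \<xi> =
    circle_deriv (circle_deriv u) \<xi> / (\<rho> \<xi>)\<^sup>2 - circle_deriv \<rho> \<xi> * circle_deriv u \<xi> / \<rho> \<xi> ^ 3
    + circle_deriv u \<xi> / (\<rho> \<xi>)\<^sup>2 * (circle_deriv v \<xi> / v \<xi> + circle_deriv w \<xi> / w \<xi>)
    - 2 * (u \<xi> ^ 4 - ((v \<xi>)\<^sup>2 - (w \<xi>)\<^sup>2)\<^sup>2) / (u \<xi> * (v \<xi>)\<^sup>2 * (w \<xi>)\<^sup>2)"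

text \<open>
  Since the other two warping functions enter symmetrically, cyclic permutations of \<open>f, g, h\<close> suffice
  for the curvature computation while all six pairs can be compared.
\<close>

lemma warping_rhs_commute: "warping_rhs \<rho> u v w \<xi> = warping_rhs \<rho> u w v \<xi>"
  by (simp add: warping_rhs_def power2_commute[of "(v \<xi>)\<^sup>2"] add.commute mult.commute mult.left_commute)

definition warping_evolution where
  "warping_evolution I \<rho> u v w \<longleftrightarrow> (\<forall>t\<in>I. \<forall>\<xi>\<in>S1.
    ((\<lambda>s. u \<xi> s) has_real_derivative
      warping_rhs (\<lambda>\<xi>. \<rho> \<xi> t) (\<lambda>\<xi>. u \<xi> t) (\<lambda>\<xi>. v \<xi> t) (\<lambda>\<xi>. w \<xi> t) \<xi>) (at t within I))"

lemma ricci_warped: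
  fixes u :: "4 \<Rightarrow> complex \<Rightarrow> real"
  assumes u: "\<And>a. circle_differentiable (u a)" and du: "\<And>a. circle_differentiable (circle_deriv (u a))"
    and pos: "\<forall>a. \<forall>\<xi>\<in>S1. 0 < u a \<xi>"
    and ijk: "(i, j, k) \<in> {(1, 2, 3), (2, 3, 1), (3, 1, 2)}"
    and p: "fst p \<in> S1"
  shows "ricci (diag_metric (\<lambda>a \<xi>. (u a \<xi>)\<^sup>2)) (frame_field i) (frame_field i) p =
    - u i (fst p) * warping_rhs (u 0) (u i) (u j) (u k) (fst p)"
proof -
  have "\<forall>a. \<forall>\<xi>\<in>S1. (u a \<xi>)\<^sup>2 \<noteq> 0" using pos by (metis less_irrefl power_eq_0_iff)
  note ricci = ricci_diag_spatial[OF circle_deriv_square(1,3)[OF u du] this p ijk refl]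
  have nz: "u a (fst p) \<noteq> 0" for a using pos p by (metis less_irrefl)
  show ?thesis
    unfolding ricci circle_deriv_square(2,4)[OF u du p] warping_rhs_def
    using nz[of 0] nz[of i] nz[of j] nz[of k]
    by (simp add: divide_simps) algebra
qed

text \<open>
  The flow equation prescribes the time derivative of the square of a warping function. Composing with
  the square root gives that of the function itself, also when the time interval is a single point and
  one-sided derivatives are not unique.
\<close>

lemma ricci_flow_evolution:
  fixes U :: "4 \<Rightarrow> complex \<Rightarrow> real \<Rightarrow> real"
  assumes smooth: "\<And>a. smooth_circle_time I (U a)"
    and pos: "\<And>a \<xi> t. \<xi> \<in> S1 \<Longrightarrow> t \<in> I \<Longrightarrow> 0 < U a \<xi> t"
    and flow: "ricci_flow I (milnor_metric (U 0) (U 1) (U 2) (U 3))"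
    and ijk: "(i, j, k) \<in> {(1, 2, 3), (2, 3, 1), (3, 1, 2)}"
  shows "warping_evolution I (U 0) (U i) (U j) (U k)"
  unfolding warping_evolution_def
proof (intro ballI)
  fix t \<xi>
  assume t: "t \<in> I" and \<xi>: "\<xi> \<in> S1"
  \<comment> \<open>Any point of the fibre over \<open>\<xi>\<close> would do; the identity matrix is one.\<close>
  define p :: pt where "p = (\<xi>, mat 1)"
  have "conj_transpose (mat 1) = mat 1"
    by (simp add: conj_transpose_def mat_def vec_eq_iff)
  then have p: "p \<in> S1xS3" "fst p \<in> S1" using \<xi> by (simp_all add: p_def S1xS3_def SU2_def)
  have metric: "milnor_metric (U 0) (U 1) (U 2) (U 3) s = diag_metric (\<lambda>a \<xi>. (U a \<xi> s)\<^sup>2)" for s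
    by (simp add: fun_eq_iff milnor_metric_def diag_metric_def sum_four)
  let ?r = "warping_rhs (\<lambda>\<xi>. U 0 \<xi> t) (\<lambda>\<xi>. U i \<xi> t) (\<lambda>\<xi>. U j \<xi> t) (\<lambda>\<xi>. U k \<xi> t) \<xi>"
  have "((\<lambda>s. diag_metric (\<lambda>a \<xi>. (U a \<xi> s)\<^sup>2) p (axis i 1) (axis i 1)) has_real_derivative
      - 2 * ricci (diag_metric (\<lambda>a \<xi>. (U a \<xi> t)\<^sup>2)) (frame_field i) (frame_field i) p) (at t within I)"
    using flow t p(1) unfolding ricci_flow_def metric frame_field_def by blast
  then have "((\<lambda>s. (U i \<xi> s)\<^sup>2) has_real_derivative 2 * U i \<xi> t * ?r) (at t within I)"
    using ricci_warped[of "\<lambda>a \<xi>. U a \<xi> t", OF smooth_circle_time_differentiable[OF smooth t] _ ijk p(2)]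
      pos t by (simp add: diag_metric_axis p_def mult.assoc)
  then have "((\<lambda>s. sqrt ((U i \<xi> s)\<^sup>2)) has_real_derivative
      inverse (sqrt ((U i \<xi> t)\<^sup>2)) / 2 * (2 * U i \<xi> t * ?r)) (at t within I)"
    using pos[OF \<xi> t, of i] by (intro DERIV_chain2[OF DERIV_real_sqrt]) simp_all
  then have "((\<lambda>s. sqrt ((U i \<xi> s)\<^sup>2)) has_real_derivative ?r) (at t within I)"
    using pos[OF \<xi> t, of i] by (simp add: field_simps)
  then show "((\<lambda>s. U i \<xi> s) has_real_derivative ?r) (at t within I)"
    by (rule has_field_derivative_transform_within[OF _ zero_less_one t])
      (use pos[OF \<xi>] in \<open>simp add: less_imp_le\<close>)
qed

section \<open>Comparison of two warping functions\<close>

text \<open>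
  The cofactor of \<open>v - u\<close> in the difference of the evolution equations of \<open>v\<close> and \<open>u\<close> at a point where
  both have the same derivative \<open>q\<close>. The first summand comes from the gradient terms, because
  \<open>q\<^sup>2 (1/u - 1/v) = q\<^sup>2 (v - u) / (u v)\<close>. The second one comes from the curvature of the fibre: over the
  common denominator \<open>u\<^sup>2 v\<^sup>2 w\<^sup>2\<close> the numerator is
  \<open>v\<^sup>5 - u\<^sup>5 - v (u\<^sup>2 - w\<^sup>2)\<^sup>2 + u (v\<^sup>2 - w\<^sup>2)\<^sup>2\<close>, which vanishes for \<open>u = v\<close>.
\<close>

definition reaction_factor :: "real \<Rightarrow> real \<Rightarrow> real \<Rightarrow> real \<Rightarrow> real \<Rightarrow> real" where
  "reaction_factor r q u v w = q\<^sup>2 / (r\<^sup>2 * u * v)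
    - 2 * (v^4 + v^3 * u + v\<^sup>2 * u\<^sup>2 + v * u^3 + u^4 + u * v * (u\<^sup>2 + u * v + v\<^sup>2)
      - 2 * u * v * w\<^sup>2 - w^4) / (u\<^sup>2 * v\<^sup>2 * w\<^sup>2)"

lemma warping_rhs_diff:
  assumes "circle_deriv v \<xi> = circle_deriv u \<xi>"
    and pos: "\<rho> \<xi> > 0" "u \<xi> > 0" "v \<xi> > 0" "w \<xi> > 0"
  shows "warping_rhs \<rho> v u w \<xi> - warping_rhs \<rho> u v w \<xi> =
    (circle_deriv (circle_deriv v) \<xi> - circle_deriv (circle_deriv u) \<xi>) / (\<rho> \<xi>)\<^sup>2
    + reaction_factor (\<rho> \<xi>) (circle_deriv u \<xi>) (u \<xi>) (v \<xi>) (w \<xi>) * (v \<xi> - u \<xi>)"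
proof -
  have nz: "\<rho> \<xi> \<noteq> 0" "u \<xi> \<noteq> 0" "v \<xi> \<noteq> 0" "w \<xi> \<noteq> 0" using pos by auto
  show ?thesis
    unfolding warping_rhs_def reaction_factor_def assms(1)
    using nz
    by (simp add: divide_simps) algebra
qed

text \<open>
  The difference \<open>v - u\<close> satisfies the hypothesis of the maximum principle with any upper bound \<open>K\<close> of
  the reaction factor. Such a bound exists on every compact time interval by continuity, since
  \<open>\<rho>, u, v, w\<close> are positive there.
\<close>

lemma warping_order_preserved:
  fixes \<rho> u v w :: "complex \<Rightarrow> real \<Rightarrow> real"
  assumes time: "is_interval I" "t0 \<in> I" "\<forall>t\<in>I. t0 \<le> t"
    and smooth: "\<forall>y\<in>{\<rho>, u, v, w}. smooth_circle_time I y"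
    and pos: "\<forall>y\<in>{\<rho>, u, v, w}. \<forall>\<xi>\<in>S1. \<forall>t\<in>I. 0 < y \<xi> t"
    and u: "warping_evolution I \<rho> u v w" and v: "warping_evolution I \<rho> v u w"
    and init: "\<forall>\<xi>\<in>S1. u \<xi> t0 \<le> v \<xi> t0"
    and T: "T \<in> I" and \<xi>: "\<xi> \<in> S1"
  shows "u \<xi> T \<le> v \<xi> T"
proof -
  have sub: "{t0..T} \<subseteq> I" using time(1,2) T by (meson atLeastAtMost_iff mem_is_interval_1_I subsetI)
  have on: "continuous_on ({0..2 * pi} \<times> {t0..T}) F" if "continuous_on (UNIV \<times> I) F" for F :: "real \<times> real \<Rightarrow> real"
    using that by (rule continuous_on_subset) (use sub in auto)
  let ?c = "\<lambda>(x, t). reaction_factor (\<rho> (cis x) t) (circle_deriv (\<lambda>\<xi>. u \<xi> t) (cis x))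
    (u (cis x) t) (v (cis x) t) (w (cis x) t)"
  have cont: "continuous_on ({0..2 * pi} \<times> {t0..T}) (\<lambda>z. y (cis (fst z)) (snd z))"
    if "y \<in> {\<rho>, u, v, w}" for y
    using on[OF smooth_circle_time_deriv(1)[OF bspec[OF smooth that]]] by (simp add: case_prod_unfold)
  have cont': "continuous_on ({0..2 * pi} \<times> {t0..T})
      (\<lambda>z. circle_deriv (\<lambda>\<xi>. u \<xi> (snd z)) (cis (fst z)))"
    using on[OF smooth_circle_time_deriv(2)[OF bspec[OF smooth, of u]]] by (simp add: case_prod_unfold)
  have pos': "0 < y (cis x) t" if "y \<in> {\<rho>, u, v, w}" "t \<in> {t0..T}" for y x t
    using pos[rule_format, of y "cis x" t] that sub by auto
  have nz: "\<rho> (cis (fst z)) (snd z) \<noteq> 0" "u (cis (fst z)) (snd z) \<noteq> 0"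
    "v (cis (fst z)) (snd z) \<noteq> 0" "w (cis (fst z)) (snd z) \<noteq> 0"
    if "z \<in> {0..2 * pi} \<times> {t0..T}" for z
    using pos'[of \<rho> "snd z" "fst z"] pos'[of u "snd z" "fst z"] pos'[of v "snd z" "fst z"]
      pos'[of w "snd z" "fst z"] that by (auto simp: mem_Times_iff)
  have "continuous_on ({0..2 * pi} \<times> {t0..T}) ?c"
    unfolding reaction_factor_def case_prod_unfold
    by (intro continuous_intros cont cont') (simp_all add: nz)
  then have "bdd_above (?c ` ({0..2 * pi} \<times> {t0..T}))"
    by (intro bounded_imp_bdd_above compact_imp_bounded compact_continuous_image compact_Times
        compact_Icc)
  then obtain K where K: "\<And>z. z \<in> {0..2 * pi} \<times> {t0..T} \<Longrightarrow> ?c z \<le> K"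
    unfolding bdd_above_def by blast
  have "0 \<le> v \<xi> T - u \<xi> T"
  proof (rule circle_maximum_principle[where W = "\<lambda>\<xi> t. v \<xi> t - u \<xi> t" and K = K])
    show "continuous_on ({0..2 * pi} \<times> {t0..T}) (\<lambda>(x, t). v (cis x) t - u (cis x) t)"
      unfolding case_prod_unfold by (intro continuous_intros cont) auto
    fix x t :: real
    assume t: "t \<in> {t0..T}"
    then have tI: "t \<in> I" using sub by blast
    note du = smooth_circle_time_deriv(3,4)[OF bspec[OF smooth, of u] tI]
      and dv = smooth_circle_time_deriv(3,4)[OF bspec[OF smooth, of v] tI]
    let ?W1 = "\<lambda>x t. circle_deriv (\<lambda>\<xi>. v \<xi> t) (cis x) - circle_deriv (\<lambda>\<xi>. u \<xi> t) (cis x)"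
    let ?W2 = "\<lambda>x t. circle_deriv (circle_deriv (\<lambda>\<xi>. v \<xi> t)) (cis x) - circle_deriv (circle_deriv (\<lambda>\<xi>. u \<xi> t)) (cis x)"
    let ?Wt = "\<lambda>x t. warping_rhs (\<lambda>\<xi>. \<rho> \<xi> t) (\<lambda>\<xi>. v \<xi> t) (\<lambda>\<xi>. u \<xi> t) (\<lambda>\<xi>. w \<xi> t) (cis x)
      - warping_rhs (\<lambda>\<xi>. \<rho> \<xi> t) (\<lambda>\<xi>. u \<xi> t) (\<lambda>\<xi>. v \<xi> t) (\<lambda>\<xi>. w \<xi> t) (cis x)"
    show "((\<lambda>y. v (cis y) t - u (cis y) t) has_real_derivative ?W1 x t) (at x)"
      by (intro DERIV_diff du dv) auto
    show "((\<lambda>y. ?W1 y t) has_real_derivative ?W2 x t) (at x)"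
      by (intro DERIV_diff du dv) auto
    show "((\<lambda>s. v (cis x) s - u (cis x) s) has_real_derivative ?Wt x t) (at t within {t0..T})"
      using u v tI unfolding warping_evolution_def
      by (intro DERIV_diff DERIV_subset[OF _ sub]) simp_all
    assume x: "x \<in> {0..2 * pi}" and neg: "v (cis x) t - u (cis x) t < 0"
      and W1: "?W1 x t = 0" and W2: "0 \<le> ?W2 x t"
    \<comment> \<open>Multiplying the bound by the negative number \<open>v - u\<close> reverses it.\<close>
    have "K * (v (cis x) t - u (cis x) t) \<le> ?c (x, t) * (v (cis x) t - u (cis x) t)"
      using K[of "(x, t)"] x t neg by (intro mult_right_mono_neg) auto
    also have "\<dots> \<le> ?W2 x t / (\<rho> (cis x) t)\<^sup>2 + ?c (x, t) * (v (cis x) t - u (cis x) t)"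
      using W2 by simp
    also have "\<dots> = ?Wt x t"
      using W1 pos'[OF _ t] by (subst warping_rhs_diff) simp_all
    finally show "K * (v (cis x) t - u (cis x) t) \<le> ?Wt x t" .
  qed (use init T \<xi> time in auto)
  then show ?thesis by simp
qed

theorem lemma26:
  fixes \<rho> f g h :: "complex \<Rightarrow> real \<Rightarrow> real" and I :: "real set" and t0 :: real
  assumes time: "is_interval I" "t0 \<in> I" "\<forall>t\<in>I. t0 \<le> t"
    and smooth: "\<forall>u\<in>{\<rho>, f, g, h}. smooth_circle_time I u"
    and pos: "\<forall>u\<in>{\<rho>, f, g, h}. \<forall>\<xi>\<in>S1. \<forall>t\<in>I. 0 < u \<xi> t"
    and flow: "ricci_flow I (milnor_metric \<rho> f g h)"
  shows "\<forall>u\<in>{f, g, h}. \<forall>v\<in>{f, g, h}.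
    (\<forall>\<xi>\<in>S1. u \<xi> t0 \<le> v \<xi> t0) \<longrightarrow> (\<forall>t\<in>I. \<forall>\<xi>\<in>S1. u \<xi> t \<le> v \<xi> t)"
proof -
  define U where "U a = (if a = 0 then \<rho> else if a = 1 then f else if a = 2 then g else h)" for a :: 4
  have U: "U 0 = \<rho>" "U 1 = f" "U 2 = g" "U 3 = h" by (simp_all add: U_def)
  have Umem: "U a \<in> {\<rho>, f, g, h}" for a by (simp add: U_def)
  have cyclic: "warping_evolution I \<rho> (U i) (U j) (U k)"
    if "(i, j, k) \<in> {(1, 2, 3), (2, 3, 1), (3, 1, 2)}" for i j k
    using ricci_flow_evolution[of I U, OF _ _ _ that] smooth pos flow Umem unfolding U by blast
  have swap: "warping_evolution I \<rho> u w v" if "warping_evolution I \<rho> u v w" for u v w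
    using that unfolding warping_evolution_def by (simp add: warping_rhs_commute)
  have ev: "warping_evolution I \<rho> f g h" "warping_evolution I \<rho> g h f"
    "warping_evolution I \<rho> h f g"
    using cyclic[of 1 2 3] cyclic[of 2 3 1] cyclic[of 3 1 2] by (simp_all add: U)
  \<comment> \<open>The swapped facts 4, 5, 6 describe the triples \<open>f h g\<close>, \<open>g f h\<close>, \<open>h g f\<close>. A comparison combines two
    triples with the same last entry.\<close>
  note ev' = ev ev[THEN swap]
  have compare: "(\<forall>\<xi>\<in>S1. u \<xi> t0 \<le> v \<xi> t0) \<longrightarrow> (\<forall>t\<in>I. \<forall>\<xi>\<in>S1. u \<xi> t \<le> v \<xi> t)"
    if sub: "{\<rho>, u, v, w} \<subseteq> {\<rho>, f, g, h}" and u: "warping_evolution I \<rho> u v w"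
      and v: "warping_evolution I \<rho> v u w" for u v w
  proof (intro impI ballI)
    fix t \<xi>
    assume init: "\<forall>\<xi>\<in>S1. u \<xi> t0 \<le> v \<xi> t0" and t: "t \<in> I" and \<xi>: "\<xi> \<in> S1"
    have "\<forall>y\<in>{\<rho>, u, v, w}. smooth_circle_time I y"
      "\<forall>y\<in>{\<rho>, u, v, w}. \<forall>\<xi>\<in>S1. \<forall>t\<in>I. 0 < y \<xi> t"
      using smooth pos sub by blast+
    then show "u \<xi> t \<le> v \<xi> t"
      using warping_order_preserved[OF time _ _ u v init t \<xi>] by blast
  qed
  have "(\<forall>\<xi>\<in>S1. u \<xi> t0 \<le> u \<xi> t0) \<longrightarrow> (\<forall>t\<in>I. \<forall>\<xi>\<in>S1. u \<xi> t \<le> u \<xi> t)" for u :: "complex \<Rightarrow> real \<Rightarrow> real"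
    by simp
  note pairs = this compare[OF _ ev'(1) ev'(5)] compare[OF _ ev'(5) ev'(1)]
    compare[OF _ ev'(4) ev'(3)] compare[OF _ ev'(3) ev'(4)]
    compare[OF _ ev'(2) ev'(6)] compare[OF _ ev'(6) ev'(2)]
  show ?thesis
    unfolding ball_simps(5,7) by (intro conjI pairs) auto
qed

end
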